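(* Let $\mathbb G$ be a group of Iwasawa type. If $\mathbb G$ is not the (unique, 15-dimensional) octonionic Heisenberg group, then $\mathbb G$ has Property (H). Property (H) fails for the 15-dimensional octonionic Heisenberg group.
   Context: A group of Heisenberg type is a simply connected Lie group $\mathbb G$ whose Lie algebra is $\mathfrak g=\mathfrak h\oplus\mathfrak v$ with $[\mathfrak h,\mathfrak h]=\mathfrak v$, $[\mathfrak h,\mathfrak v]=\{0\}$, equipped with an inner product with $\mathfrak h\perp\mathfrak v$, such that the linear map $J:\mathfrak v\to\operatorname{End}(\mathfrak h)$ defined by $\langle J(\sigma)z,z'\rangle=\langle[z,z'],\sigma\rangle$ satisfies $J(\sigma)^2=-|\sigma|^2I_{\mathfrak h}$ for all $\sigma\in\mathfrak v$. Property (H): the group $\mathscr S(\mathfrak h)=\{S\in O(\mathfrak h): SJ(\sigma)=J(\sigma)S\ \text{for all }\sigma\in\mathfrak v\}$ acts transitively on the unit sphere of $\mathfrak h$. Groups of Iwasawa type are the nilpotent components $N$ in the Iwasawa decomposition $KAN$ of the simple Lie groups of real rank one (equivalently, boundaries of real, complex, quaternionic or octonionic hyperbolic spaces). Up to isometric isomorphism they are: $\mathbb R^n$ (the degenerate Abelian case, $\mathfrak v=\{0\}$, so $\mathscr S(\mathfrak h)=O(\mathfrak h)$), or $\mathbb K^n\times\operatorname{Im}\mathbb K$ with $\mathbb K=\mathbb C$ or $\mathbb K=\mathbb H$ (quaternions) and $n\ge1$, or $\mathbb K=\mathbb O$ (octonions) and $n=1$ (the octonionic Heisenberg group, of dimension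 15), with group law $$(q_o,\omega_o)\circ(q,\omega)=\Big(q_o+q,\ \omega_o+\omega+\tfrac12\operatorname{Im}(\bar q_oq)\Big),\qquad \bar q_oq=\sum_{\alpha=1}^n\bar q_o^\alpha q^\alpha,$$ Lie bracket $[(q_o,\omega_o),(q,\omega)]=\operatorname{Im}(\bar q_oq)$, $\mathfrak h=\mathbb K^n$, $\mathfrak v=\operatorname{Im}\mathbb K$ as real vector spaces, and inner product $\langle(q_o,\omega_o),(q,\omega)\rangle=\operatorname{Re}(\bar q_oq)+\operatorname{Re}(\bar\omega_o\omega)$. *)

theory Defs
  imports "HOL-Analysis.Analysis"
begin

section \<open>Groups of Heisenberg type\<close>

text \<open>
  A simply connected nilpotent Lie group is identified with its Lie algebra through the exponential
  map, so a step-two group is given by its Lie algebra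
  \<open>\<gg> = \<hh> \<oplus> \<vv>\<close> together with the Baker-Campbell-Hausdorff product
  \<open>x \<circ> y = x + y + 1/2 [x, y]\<close>. The subspaces \<open>\<hh>\<close> and \<open>\<vv>\<close> lie in an ambient inner product
  space which may be larger than \<open>\<gg>\<close>; all conditions are relative to \<open>\<gg>\<close>.
\<close>

record 'a step_two_group =
  hor :: "'a set"
  ver :: "'a set"
  bracket :: "'a \<Rightarrow> 'a \<Rightarrow> 'a"

definition carrier :: "'a::real_inner step_two_group \<Rightarrow> 'a set" where
  "carrier G = {z + \<sigma> | z \<sigma>. z \<in> hor G \<and> \<sigma> \<in> ver G}"

definition group_mult :: "'a::real_inner step_two_group \<Rightarrow> 'a \<Rightarrow> 'a \<Rightarrow> 'a" where
  "group_mult G x y = x + y + (1/2) *\<^sub>R bracket G x y"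

definition linear_map_on :: "'a::real_vector set \<Rightarrow> ('a \<Rightarrow> 'b::real_vector) \<Rightarrow> bool" where
  "linear_map_on U f \<longleftrightarrow>
     (\<forall>x\<in>U. \<forall>y\<in>U. f (x + y) = f x + f y) \<and> (\<forall>c. \<forall>x\<in>U. f (c *\<^sub>R x) = c *\<^sub>R f x)"

definition lie_algebra :: "'a::real_inner step_two_group \<Rightarrow> bool" where
  "lie_algebra G \<longleftrightarrow>
     subspace (carrier G) \<and> (\<exists>B. finite B \<and> span B = carrier G) \<and>
     (\<forall>x\<in>carrier G. \<forall>y\<in>carrier G. bracket G x y \<in> carrier G) \<and>
     (\<forall>y\<in>carrier G. linear_map_on (carrier G) (\<lambda>x. bracket G x y)) \<and>
     (\<forall>x\<in>carrier G. linear_map_on (carrier G) (bracket G x)) \<and>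
     (\<forall>x\<in>carrier G. bracket G x x = 0) \<and>
     (\<forall>x\<in>carrier G. \<forall>y\<in>carrier G. \<forall>z\<in>carrier G.
        bracket G x (bracket G y z) + bracket G y (bracket G z x) + bracket G z (bracket G x y) = 0)"

text \<open>The vector \<open>J(\<sigma>)z \<in> \<hh>\<close> representing the functional
  \<open>z' \<mapsto> \<langle>[z, z'], \<sigma>\<rangle>\<close> on \<open>\<hh>\<close>.\<close>

definition J_map :: "'a::real_inner step_two_group \<Rightarrow> 'a \<Rightarrow> 'a \<Rightarrow> 'a" where
  "J_map G \<sigma> z = (THE w. w \<in> hor G \<and> (\<forall>z'\<in>hor G. w \<bullet> z' = bracket G z z' \<bullet> \<sigma>))"

definition heisenberg_type :: "'a::real_inner step_two_group \<Rightarrow> bool" where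
  "heisenberg_type G \<longleftrightarrow>
     subspace (hor G) \<and> subspace (ver G) \<and>
     (\<forall>z\<in>hor G. \<forall>\<sigma>\<in>ver G. z \<bullet> \<sigma> = 0) \<and>
     lie_algebra G \<and>
     span {bracket G z z' | z z'. z \<in> hor G \<and> z' \<in> hor G} = ver G \<and>
     (\<forall>z\<in>hor G. \<forall>\<sigma>\<in>ver G. bracket G z \<sigma> = 0) \<and>
     (\<forall>\<sigma>\<in>ver G. \<forall>z\<in>hor G. J_map G \<sigma> (J_map G \<sigma> z) = - ((norm \<sigma>)\<^sup>2 *\<^sub>R z))"

text \<open>Only the values on \<open>H\<close> matter: maps are not required to vanish outside \<open>H\<close>.\<close>

definition orthogonal_group :: "'a::real_inner set \<Rightarrow> ('a \<Rightarrow> 'a) set" where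
  "orthogonal_group H =
     {S. S ` H = H \<and> linear_map_on H S \<and> (\<forall>z\<in>H. \<forall>z'\<in>H. S z \<bullet> S z' = z \<bullet> z')}"

definition J_commuting_group :: "'a::real_inner step_two_group \<Rightarrow> ('a \<Rightarrow> 'a) set" where
  "J_commuting_group G =
     {S \<in> orthogonal_group (hor G). \<forall>\<sigma>\<in>ver G. \<forall>z\<in>hor G. S (J_map G \<sigma> z) = J_map G \<sigma> (S z)}"

definition property_H :: "'a::real_inner step_two_group \<Rightarrow> bool" where
  "property_H G \<longleftrightarrow>
     (\<forall>x\<in>hor G. \<forall>y\<in>hor G. norm x = 1 \<longrightarrow> norm y = 1 \<longrightarrow> (\<exists>S\<in>J_commuting_group G. S x = y))"

text \<open>In exponential coordinates a Lie group isomorphism is linear (it agrees with its differential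
  at the identity), and it is isometric when this linear map is.\<close>

definition isometrically_isomorphic ::
    "'a::real_inner step_two_group \<Rightarrow> 'b::real_inner step_two_group \<Rightarrow> bool" where
  "isometrically_isomorphic G G' \<longleftrightarrow>
     (\<exists>f. bij_betw f (carrier G) (carrier G') \<and> linear_map_on (carrier G) f \<and>
        (\<forall>x\<in>carrier G. \<forall>y\<in>carrier G. f (group_mult G x y) = group_mult G' (f x) (f y)) \<and>
        (\<forall>x\<in>carrier G. \<forall>y\<in>carrier G. f x \<bullet> f y = x \<bullet> y))"


section \<open>Finitely supported sequences\<close>

text \<open>The inner product space of finitely supported sequences contains \<open>\<K>\<^sup>n\<close>, for every
  natural number \<open>n\<close>, as the subspace of sequences supported in \<open>{..<n}\<close>.\<close>

typedef (overloaded) ('k::zero) finseq = "{q :: nat \<Rightarrow> 'k. finite {i. q i \<noteq> 0}}"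
  morphisms coord Abs_finseq
  by (rule exI[of _ "\<lambda>_. 0"]) simp

setup_lifting type_definition_finseq

lemma finseq_eqI: "(\<And>i. coord p i = coord q i) \<Longrightarrow> p = q"
  by (metis coord_inject ext)

lemma finite_support: "finite {i. coord q i \<noteq> 0}"
  using coord[of q] by simp

instantiation finseq :: (real_vector) real_vector
begin

lift_definition zero_finseq :: "'a finseq" is "\<lambda>_. 0" by simp

lift_definition plus_finseq :: "'a finseq \<Rightarrow> 'a finseq \<Rightarrow> 'a finseq" is "\<lambda>p q i. p i + q i"
  subgoal for p q
    by (rule finite_subset[of _ "{i. p i \<noteq> 0} \<union> {i. q i \<noteq> 0}"]) auto
  done

lift_definition uminus_finseq :: "'a finseq \<Rightarrow> 'a finseq" is "\<lambda>p i. - p i" by simp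

lift_definition minus_finseq :: "'a finseq \<Rightarrow> 'a finseq \<Rightarrow> 'a finseq" is "\<lambda>p q i. p i - q i"
  subgoal for p q
    by (rule finite_subset[of _ "{i. p i \<noteq> 0} \<union> {i. q i \<noteq> 0}"]) auto
  done

lift_definition scaleR_finseq :: "real \<Rightarrow> 'a finseq \<Rightarrow> 'a finseq" is "\<lambda>c p i. c *\<^sub>R p i"
  subgoal for c p
    by (rule finite_subset[of _ "{i. p i \<noteq> 0}"]) auto
  done

instance
  by standard (transfer; simp add: fun_eq_iff algebra_simps)+

end

lemmas coord_simps [simp] =
  zero_finseq.rep_eq plus_finseq.rep_eq uminus_finseq.rep_eq minus_finseq.rep_eq
  scaleR_finseq.rep_eq

instantiation finseq :: (real_inner) real_inner
begin

definition inner_finseq :: "'a finseq \<Rightarrow> 'a finseq \<Rightarrow> real" where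
  "inner_finseq p q = (\<Sum>i | coord p i \<noteq> 0. coord p i \<bullet> coord q i)"

definition norm_finseq :: "'a finseq \<Rightarrow> real" where
  "norm_finseq p = sqrt (p \<bullet> p)"

definition sgn_finseq :: "'a finseq \<Rightarrow> 'a finseq" where
  "sgn_finseq p = p /\<^sub>R norm p"

definition dist_finseq :: "'a finseq \<Rightarrow> 'a finseq \<Rightarrow> real" where
  "dist_finseq p q = norm (p - q)"

definition uniformity_finseq :: "('a finseq \<times> 'a finseq) filter" where
  "uniformity_finseq = (INF e\<in>{0 <..}. principal {(x, y). dist x y < e})"

definition open_finseq :: "'a finseq set \<Rightarrow> bool" where
  "open_finseq U \<longleftrightarrow> (\<forall>x\<in>U. eventually (\<lambda>(x', y). x' = x \<longrightarrow> y \<in> U) uniformity)"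

lemma inner_finseq_superset:
  assumes "finite A" "{i. coord p i \<noteq> 0} \<subseteq> A"
  shows "(p::'a finseq) \<bullet> q = (\<Sum>i\<in>A. coord p i \<bullet> coord q i)"
  unfolding inner_finseq_def using assms by (intro sum.mono_neutral_left) auto

instance
proof
  fix x y z :: "'a finseq" and r :: real
  let ?A = "{i. coord x i \<noteq> 0} \<union> {i. coord y i \<noteq> 0}"
  have A: "finite ?A" by (simp add: finite_support)
  show "x \<bullet> y = y \<bullet> x"
    using A by (simp add: inner_finseq_superset[of ?A] inner_commute)
  have "{i. coord (x + y) i \<noteq> 0} \<subseteq> ?A" by auto
  then show "(x + y) \<bullet> z = x \<bullet> z + y \<bullet> z"
    using A by (simp add: inner_finseq_superset[of ?A] inner_add_left sum.distrib)
  have "{i. coord (r *\<^sub>R x) i \<noteq> 0} \<subseteq> ?A" by auto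
  then show "(r *\<^sub>R x) \<bullet> y = r * (x \<bullet> y)"
    using A by (simp add: inner_finseq_superset[of ?A] sum_distrib_left)
  show "0 \<le> x \<bullet> x"
    unfolding inner_finseq_def by (simp add: sum_nonneg)
  show "(x \<bullet> x = 0) = (x = 0)"
    unfolding inner_finseq_def
    by (subst sum_nonneg_eq_0_iff) (auto simp: finite_support intro: finseq_eqI)
qed (simp_all add: norm_finseq_def sgn_finseq_def dist_finseq_def uniformity_finseq_def
       open_finseq_def)

end


section \<open>Quaternions and octonions\<close>

text \<open>The Cayley-Dickson doubling of an algebra with product \<open>m\<close> and conjugation \<open>c\<close>.\<close>

definition cd_cnj :: "('k \<Rightarrow> 'k::ab_group_add) \<Rightarrow> 'k \<times> 'k \<Rightarrow> 'k \<times> 'k" where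
  "cd_cnj c x = (c (fst x), - snd x)"

definition cd_mult ::
    "('k \<Rightarrow> 'k \<Rightarrow> 'k) \<Rightarrow> ('k \<Rightarrow> 'k::ab_group_add) \<Rightarrow> 'k \<times> 'k \<Rightarrow> 'k \<times> 'k \<Rightarrow> 'k \<times> 'k" where
  "cd_mult m c x y =
     (m (fst x) (fst y) - m (c (snd y)) (snd x), m (snd y) (fst x) + m (snd x) (c (fst y)))"

type_synonym quat = "complex \<times> complex"
type_synonym oct = "quat \<times> quat"

definition quat_cnj :: "quat \<Rightarrow> quat" where "quat_cnj = cd_cnj cnj"
definition quat_mult :: "quat \<Rightarrow> quat \<Rightarrow> quat" where "quat_mult = cd_mult (*) cnj"

definition oct_cnj :: "oct \<Rightarrow> oct" where "oct_cnj = cd_cnj quat_cnj"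
definition oct_mult :: "oct \<Rightarrow> oct \<Rightarrow> oct" where "oct_mult = cd_mult quat_mult quat_cnj"

text \<open>In each of these algebras the ambient inner product is \<open>Re (x\<^sup>* y)\<close>, where
  \<open>Re u = (u + u\<^sup>*) / 2\<close>, and every nonzero element is invertible since the norm is
  multiplicative.\<close>

lemma complex_inner_eq_Re: "(1/2) *\<^sub>R (cnj x * y + cnj (cnj x * y)) = of_real (x \<bullet> y)"
  by (simp add: complex_eq_iff inner_complex_def algebra_simps)

lemma quat_inner_eq_Re:
  "(1/2) *\<^sub>R (quat_mult (quat_cnj x) y + quat_cnj (quat_mult (quat_cnj x) y)) = (of_real (x \<bullet> y), 0)"
  by (simp add: prod_eq_iff quat_mult_def quat_cnj_def cd_mult_def cd_cnj_def complex_eq_iff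
      inner_prod_def inner_complex_def algebra_simps)

lemma oct_inner_eq_Re:
  "(1/2) *\<^sub>R (oct_mult (oct_cnj x) y + oct_cnj (oct_mult (oct_cnj x) y))
     = ((of_real (x \<bullet> y), 0), 0)"
  by (simp add: prod_eq_iff oct_mult_def oct_cnj_def quat_mult_def quat_cnj_def cd_mult_def
      cd_cnj_def complex_eq_iff inner_prod_def inner_complex_def algebra_simps)

lemma quat_norm_mult: "norm (quat_mult x y) = norm x * norm y"
  unfolding norm_eq_sqrt_inner real_sqrt_mult[symmetric]
  by (simp add: quat_mult_def cd_mult_def inner_prod_def inner_complex_def algebra_simps)

lemma oct_norm_mult: "norm (oct_mult x y) = norm x * norm y"
  unfolding norm_eq_sqrt_inner real_sqrt_mult[symmetric]
  by (simp add: oct_mult_def quat_mult_def quat_cnj_def cd_mult_def cd_cnj_def inner_prod_def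
      inner_complex_def algebra_simps)


section \<open>Groups of Iwasawa type\<close>

definition coord_space :: "nat \<Rightarrow> 'k::zero finseq set" where
  "coord_space n = {q. \<forall>i\<ge>n. coord q i = 0}"

definition abelian_group :: "nat \<Rightarrow> real finseq step_two_group" where
  "abelian_group n = \<lparr>hor = coord_space n, ver = {0}, bracket = (\<lambda>_ _. 0)\<rparr>"

definition im_part :: "('k \<Rightarrow> 'k) \<Rightarrow> 'k::real_vector \<Rightarrow> 'k" where
  "im_part c x = (1/2) *\<^sub>R (x - c x)"

definition heisenberg_group ::
    "('k \<Rightarrow> 'k \<Rightarrow> 'k) \<Rightarrow> ('k \<Rightarrow> 'k) \<Rightarrow> nat \<Rightarrow> ('k::real_inner finseq \<times> 'k) step_two_group" where
  "heisenberg_group m c n =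
     \<lparr>hor = coord_space n \<times> {0},
      ver = {0} \<times> range (im_part c),
      bracket = (\<lambda>x y. (0, im_part c (\<Sum>\<alpha><n. m (c (coord (fst x) \<alpha>)) (coord (fst y) \<alpha>))))\<rparr>"

lemma group_mult_heisenberg_group:
  "group_mult (heisenberg_group m c n) (p, v) (q, w) =
     (p + q, v + w + (1/2) *\<^sub>R im_part c (\<Sum>\<alpha><n. m (c (coord p \<alpha>)) (coord q \<alpha>)))"
  by (simp add: group_mult_def heisenberg_group_def)

definition octonionic_heisenberg_group :: "(oct finseq \<times> oct) step_two_group" where
  "octonionic_heisenberg_group = heisenberg_group oct_mult oct_cnj 1"

definition octonionic :: "'a::real_inner step_two_group \<Rightarrow> bool" where
  "octonionic G \<longleftrightarrow> isometrically_isomorphic G octonionic_heisenberg_group"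

text \<open>The nilpotent components of the Iwasawa decompositions of the simple Lie groups of real
  rank one, as classified up to isometric isomorphism.\<close>

definition iwasawa_type :: "'a::real_inner step_two_group \<Rightarrow> bool" where
  "iwasawa_type G \<longleftrightarrow> heisenberg_type G \<and>
     ((\<exists>n\<ge>1. isometrically_isomorphic G (abelian_group n)) \<or>
      (\<exists>n\<ge>1. isometrically_isomorphic G (heisenberg_group (*) cnj n)) \<or>
      (\<exists>n\<ge>1. isometrically_isomorphic G (heisenberg_group quat_mult quat_cnj n)) \<or>
      octonionic G)"

end

theory Submission
  imports Defs
begin

text \<open>
  An isometric isomorphism of groups of Heisenberg type intertwines the maps \<open>J\<close>, so property (H)
  can be decided in the models. In \<open>\<K>\<^sup>n \<times> Im \<K>\<close> the map \<open>J(\<sigma>)\<close> is the right multiplication by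
  \<open>\<sigma>\<close>. If \<open>\<K>\<close> is associative, the \<open>\<K>\<close>-hermitian reflections
  \<open>z \<mapsto> z - (x - y) \<langle>x - y, x\<rangle>\<^sup>-\<^sup>1 \<langle>x - y, z\<rangle>\<close> commute with \<open>J\<close> and act transitively on the unit
  sphere; in the Abelian case ordinary reflections do. Over the octonions a map commuting with \<open>J\<close>
  is a left multiplication by an element of the nucleus, hence \<open>\<plusminus>1\<close>.
\<close>

section \<open>Linear maps on a subspace\<close>

lemma linear_map_on_zero: "linear_map_on U f \<Longrightarrow> 0 \<in> U \<Longrightarrow> f 0 = 0"
  unfolding linear_map_on_def by (metis scaleR_zero_left)

text \<open>Extend the values of \<open>g\<close> on a basis of \<open>W\<close> to the whole space;
  \<open>h\<close> and \<open>g\<close> then agree on the span. This opens theorems about globally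
  linear maps to maps that are linear only on a subspace.\<close>

lemma linear_map_on_eq_linear:
  fixes g :: "'a::real_vector \<Rightarrow> 'b::real_vector"
  assumes "subspace W" "linear_map_on W g"
  obtains h where "linear h" "\<And>x. x \<in> W \<Longrightarrow> h x = g x"
proof -
  obtain B where B: "B \<subseteq> W" "independent B" "W \<subseteq> span B"
    using real_vector.basis_exists[of W] by metis
  have sB: "span B = W"
    using B assms(1) by (simp add: span_subspace)
  obtain h where h: "linear h" "\<And>x. x \<in> B \<Longrightarrow> h x = g x"
    using linear_independent_extend[OF B(2), of g] by metis
  have "x \<in> W \<and> h x = g x" if "x \<in> span B" for x
    using that
  proof (induction rule: span_induct_alt)
    case base
    show ?case
      using linear_map_on_zero[OF assms(2)] linear_0[OF h(1)] assms(1) by (simp add: subspace_0)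
  next
    case (step c x y)
    then show ?case
      using assms B(1) h(2)
      by (auto simp: linear_add[OF h(1)] linear_scale[OF h(1)] linear_map_on_def
          subspace_add subspace_scale subset_iff)
  qed
  then show thesis
    using that[OF h(1)] sB by blast
qed

text \<open>An injective linear map carries a basis of \<open>W\<close> to a basis of
  \<open>C\<close>. It serves to compute a dimension inside the infinite-dimensional space of
  finitely supported sequences.\<close>

lemma dim_eq_of_linear_bij:
  fixes g :: "'a::real_vector \<Rightarrow> 'b::real_vector"
  assumes W: "subspace W" and g: "linear_map_on W g" "bij_betw g W C"
  shows "dim C = dim W"
proof -
  obtain h where h: "linear h" "\<And>x. x \<in> W \<Longrightarrow> h x = g x"
    using linear_map_on_eq_linear[OF W g(1)] by metis
  have "bij_betw h W C"
    using g(2) h(2) bij_betw_cong by blast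
  then have inj: "inj_on h W" and C: "h ` W = C"
    by (auto simp: bij_betw_def)
  obtain B where B: "B \<subseteq> W" "independent B" "W \<subseteq> span B"
    using real_vector.basis_exists[of W] by metis
  have sB: "span B = W"
    using B W by (simp add: span_subspace)
  have "independent (h ` B)"
    using linear_independent_injective_image[OF h(1) B(2)] inj sB by simp
  moreover have "span (h ` B) = C"
    using linear_span_image[OF h(1)] sB C by metis
  moreover have "card (h ` B) = card B"
    using inj B(1) by (meson card_image inj_on_subset)
  moreover have "card B = dim W"
    using B(2) sB by (metis real_vector.dim_eq_card_independent real_vector.dim_span)
  ultimately show ?thesis
    by (metis real_vector.dim_eq_card_independent real_vector.dim_span)
qed

section \<open>Isometric isomorphisms and property (H)\<close>

lemma inner_eq_on_imp_eq:
  assumes "subspace H" "v \<in> H" "w \<in> H" "\<And>z. z \<in> H \<Longrightarrow> v \<bullet> z = w \<bullet> z"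
  shows "v = w"
proof -
  have "v - w \<in> H"
    using assms by (simp add: subspace_diff)
  then have "(v - w) \<bullet> (v - w) = 0"
    using assms(4) by (simp add: inner_diff_left)
  then show ?thesis
    by simp
qed

text \<open>The representing vector is unique because the inner product is nondegenerate on
  \<open>hor G\<close>, so any vector with the defining property is the value of the
  description.\<close>

lemma J_map_eqI:
  assumes "subspace (hor G)" "w \<in> hor G" "\<And>z'. z' \<in> hor G \<Longrightarrow> w \<bullet> z' = bracket G z z' \<bullet> \<sigma>"
  shows "J_map G \<sigma> z = w"
  unfolding J_map_def
proof (rule the_equality)
  show "w \<in> hor G \<and> (\<forall>z'\<in>hor G. w \<bullet> z' = bracket G z z' \<bullet> \<sigma>)"
    using assms by blast
  show "v = w" if "v \<in> hor G \<and> (\<forall>z'\<in>hor G. v \<bullet> z' = bracket G z z' \<bullet> \<sigma>)" for v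
    using inner_eq_on_imp_eq[OF assms(1)] assms that by metis
qed

text \<open>Everything that property (H) can see: the horizontal inner product space and the family
  of maps \<open>J\<close>, with parameters matched in both directions. Membership of
  \<open>J_map G \<sigma> z\<close> in \<open>hor G\<close> is recorded because a definite
  description does not guarantee it.\<close>

definition J_equivalence ::
    "('a \<Rightarrow> 'b) \<Rightarrow> 'a::real_inner step_two_group \<Rightarrow> 'b::real_inner step_two_group \<Rightarrow> bool" where
  "J_equivalence f G M \<longleftrightarrow>
     subspace (hor G) \<and> bij_betw f (hor G) (hor M) \<and> linear_map_on (hor G) f \<and>
     (\<forall>x\<in>hor G. \<forall>y\<in>hor G. f x \<bullet> f y = x \<bullet> y) \<and>
     (\<forall>\<sigma>\<in>ver G. \<exists>\<tau>\<in>ver M. \<forall>z\<in>hor G. J_map G \<sigma> z \<in> hor G \<and> f (J_map G \<sigma> z) = J_map M \<tau> (f z)) \<and>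
     (\<forall>\<tau>\<in>ver M. \<exists>\<sigma>\<in>ver G. \<forall>z\<in>hor G. J_map G \<sigma> z \<in> hor G \<and> f (J_map G \<sigma> z) = J_map M \<tau> (f z))"

text \<open>The reverse direction transports property (H) from a group to its model, which settles
  the octonionic case.\<close>

lemma J_equivalence_inverse:
  assumes "J_equivalence f G M" "subspace (hor M)"
  shows "J_equivalence (the_inv_into (hor G) f) M G"
proof -
  let ?g = "the_inv_into (hor G) f"
  have G: "subspace (hor G)" and bij: "bij_betw f (hor G) (hor M)"
    and lin: "linear_map_on (hor G) f"
    and iso: "\<And>x y. x \<in> hor G \<Longrightarrow> y \<in> hor G \<Longrightarrow> f x \<bullet> f y = x \<bullet> y"
    and J1: "\<And>\<sigma>. \<sigma> \<in> ver G \<Longrightarrow> \<exists>\<tau>\<in>ver M. \<forall>z\<in>hor G. J_map G \<sigma> z \<in> hor G \<and> f (J_map G \<sigma> z) = J_map M \<tau> (f z)"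
    and J2: "\<And>\<tau>. \<tau> \<in> ver M \<Longrightarrow> \<exists>\<sigma>\<in>ver G. \<forall>z\<in>hor G. J_map G \<sigma> z \<in> hor G \<and> f (J_map G \<sigma> z) = J_map M \<tau> (f z)"
    using assms unfolding J_equivalence_def by blast+
  have bij': "bij_betw ?g (hor M) (hor G)"
    using bij by (rule bij_betw_the_inv_into)
  have gin: "?g y \<in> hor G" if "y \<in> hor M" for y
    using bij' that by (meson bij_betwE)
  have fin: "f x \<in> hor M" if "x \<in> hor G" for x
    using bij that by (meson bij_betwE)
  have fg: "f (?g y) = y" if "y \<in> hor M" for y
    using bij that by (simp add: f_the_inv_into_f_bij_betw)
  have gf: "?g (f x) = x" if "x \<in> hor G" for x
    using bij that by (simp add: bij_betw_def the_inv_into_f_f)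
  have add: "f (x + y) = f x + f y" if "x \<in> hor G" "y \<in> hor G" for x y
    using lin that unfolding linear_map_on_def by blast
  have scale: "f (c *\<^sub>R x) = c *\<^sub>R f x" if "x \<in> hor G" for c x
    using lin that unfolding linear_map_on_def by blast
  have "linear_map_on (hor M) ?g"
    unfolding linear_map_on_def
  proof (intro conjI ballI allI)
    fix x y assume xy: "x \<in> hor M" "y \<in> hor M"
    have "?g (f (?g x + ?g y)) = ?g x + ?g y"
      using gf gin xy G by (simp add: subspace_add)
    then show "?g (x + y) = ?g x + ?g y"
      using add gin xy fg by simp
  next
    fix c x assume x: "x \<in> hor M"
    have "?g (f (c *\<^sub>R ?g x)) = c *\<^sub>R ?g x"
      using gf gin x G by (simp add: subspace_scale)
    then show "?g (c *\<^sub>R x) = c *\<^sub>R ?g x"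
      using scale gin x fg by simp
  qed
  moreover have "?g x \<bullet> ?g y = x \<bullet> y" if "x \<in> hor M" "y \<in> hor M" for x y
    using iso[of "?g x" "?g y"] fg gin that by simp
  moreover have "J_map M \<tau> z \<in> hor M \<and> ?g (J_map M \<tau> z) = J_map G \<sigma> (?g z)"
    if "\<forall>z\<in>hor G. J_map G \<sigma> z \<in> hor G \<and> f (J_map G \<sigma> z) = J_map M \<tau> (f z)" "z \<in> hor M" for \<sigma> \<tau> z
    using that gin[OF that(2)] fg[OF that(2)] fin gf by metis
  ultimately show ?thesis
    unfolding J_equivalence_def using assms(2) bij' J1 J2 by meson
qed

text \<open>If \<open>S\<close> commutes with the maps \<open>J\<close> of \<open>M\<close>, its
  conjugate by \<open>f\<close> commutes with those of \<open>G\<close>; transitivity is transported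
  with it.\<close>

lemma property_H_J_equivalence:
  assumes "J_equivalence f G M" "subspace (hor M)" "property_H M"
  shows "property_H G"
  unfolding property_H_def
proof (intro ballI impI)
  fix x y assume xy: "x \<in> hor G" "y \<in> hor G" "norm x = 1" "norm y = 1"
  let ?g = "the_inv_into (hor G) f"
  have G: "subspace (hor G)" and bij: "bij_betw f (hor G) (hor M)"
    and lin: "linear_map_on (hor G) f"
    and iso: "\<And>x y. x \<in> hor G \<Longrightarrow> y \<in> hor G \<Longrightarrow> f x \<bullet> f y = x \<bullet> y"
    and J1: "\<And>\<sigma>. \<sigma> \<in> ver G \<Longrightarrow> \<exists>\<tau>\<in>ver M. \<forall>z\<in>hor G. J_map G \<sigma> z \<in> hor G \<and> f (J_map G \<sigma> z) = J_map M \<tau> (f z)"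
    using assms unfolding J_equivalence_def by blast+
  have inv: "J_equivalence ?g M G"
    using J_equivalence_inverse assms(1,2) by blast
  have bij': "bij_betw ?g (hor M) (hor G)" and lin': "linear_map_on (hor M) ?g"
    and iso': "\<And>x y. x \<in> hor M \<Longrightarrow> y \<in> hor M \<Longrightarrow> ?g x \<bullet> ?g y = x \<bullet> y"
    using inv unfolding J_equivalence_def by blast+
  have gf: "?g (f x) = x" if "x \<in> hor G" for x
    using bij that by (simp add: bij_betw_def the_inv_into_f_f)
  have fg: "f (?g y) = y" if "y \<in> hor M" for y
    using bij that by (simp add: f_the_inv_into_f_bij_betw)
  have fin: "f x \<in> hor M" if "x \<in> hor G" for x
    using bij that by (meson bij_betwE)
  have norm: "norm (f x) = 1" "norm (f y) = 1"
    using xy iso by (simp_all add: norm_eq_sqrt_inner)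
  obtain S where S: "S \<in> J_commuting_group M" "S (f x) = f y"
    using assms(3) xy norm fin unfolding property_H_def by meson
  have Sim: "S ` hor M = hor M" and Slin: "linear_map_on (hor M) S"
    and Siso: "\<And>z z'. z \<in> hor M \<Longrightarrow> z' \<in> hor M \<Longrightarrow> S z \<bullet> S z' = z \<bullet> z'"
    and SJ: "\<And>\<tau> z. \<tau> \<in> ver M \<Longrightarrow> z \<in> hor M \<Longrightarrow> S (J_map M \<tau> z) = J_map M \<tau> (S z)"
    using S(1) unfolding J_commuting_group_def orthogonal_group_def by blast+
  have Sin: "S z \<in> hor M" if "z \<in> hor M" for z
    using Sim that by blast
  let ?S = "\<lambda>z. ?g (S (f z))"
  have "?S ` hor G = ?g ` (S ` (f ` hor G))"
    by (simp add: image_image)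
  also have "\<dots> = hor G"
    using bij bij' Sim by (simp add: bij_betw_def)
  finally have "?S ` hor G = hor G" .
  moreover have "linear_map_on (hor G) ?S"
    using lin lin' Slin fin Sin unfolding linear_map_on_def by simp
  moreover have "\<forall>z\<in>hor G. \<forall>z'\<in>hor G. ?S z \<bullet> ?S z' = z \<bullet> z'"
    using iso iso' Siso fin Sin by simp
  moreover have "?S (J_map G \<sigma> z) = J_map G \<sigma> (?S z)" if \<sigma>: "\<sigma> \<in> ver G" and z: "z \<in> hor G" for \<sigma> z
  proof -
    obtain \<tau> where \<tau>: "\<tau> \<in> ver M" "\<forall>z\<in>hor G. J_map G \<sigma> z \<in> hor G \<and> f (J_map G \<sigma> z) = J_map M \<tau> (f z)"
      using J1[OF \<sigma>] by blast
    have Sz: "?S z \<in> hor G"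
      using bij' Sin fin z by (meson bij_betwE)
    have "?S (J_map G \<sigma> z) = ?g (J_map M \<tau> (S (f z)))"
      using \<tau> z SJ fin by simp
    also have "J_map M \<tau> (S (f z)) = f (J_map G \<sigma> (?S z))"
      using \<tau>(2) Sz fg Sin fin z by simp
    also have "?g \<dots> = J_map G \<sigma> (?S z)"
      using gf \<tau>(2) Sz by metis
    finally show ?thesis .
  qed
  ultimately have "?S \<in> J_commuting_group G"
    by (simp add: J_commuting_group_def orthogonal_group_def)
  moreover have "?S x = y"
    using S(2) gf xy by simp
  ultimately show "\<exists>S\<in>J_commuting_group G. S x = y"
    by (intro bexI[of _ ?S])
qed

section \<open>Bracket identities in a Lie algebra\<close>

lemma lie_algebra_bracket:
  assumes "lie_algebra G" "x \<in> carrier G" "y \<in> carrier G" "z \<in> carrier G"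
  shows "bracket G x y \<in> carrier G"
    and "bracket G (x + y) z = bracket G x z + bracket G y z"
    and "bracket G x (y + z) = bracket G x y + bracket G x z"
    and "bracket G x (c *\<^sub>R y) = c *\<^sub>R bracket G x y"
    and "bracket G x 0 = 0"
    and "bracket G y x = - bracket G x y"
    and "bracket G x (bracket G y z) + bracket G y (bracket G z x) + bracket G z (bracket G x y) = 0"
proof -
  have sub: "subspace (carrier G)"
    using assms unfolding lie_algebra_def by blast
  have c: "bracket G x y \<in> carrier G" if "x \<in> carrier G" "y \<in> carrier G" for x y
    using assms(1) that unfolding lie_algebra_def by blast
  have l: "bracket G (x + y) z = bracket G x z + bracket G y z"
    if "x \<in> carrier G" "y \<in> carrier G" "z \<in> carrier G" for x y z
    using assms(1) that unfolding lie_algebra_def linear_map_on_def by blast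
  have r: "bracket G x (y + z) = bracket G x y + bracket G x z"
    if "x \<in> carrier G" "y \<in> carrier G" "z \<in> carrier G" for x y z
    using assms(1) that unfolding lie_algebra_def linear_map_on_def by blast
  have s: "bracket G x (c *\<^sub>R y) = c *\<^sub>R bracket G x y"
    if "x \<in> carrier G" "y \<in> carrier G" for x y c
    using assms(1) that unfolding lie_algebra_def linear_map_on_def by blast
  have a: "bracket G x x = 0" if "x \<in> carrier G" for x
    using assms(1) that unfolding lie_algebra_def by blast
  show "bracket G x y \<in> carrier G" "bracket G (x + y) z = bracket G x z + bracket G y z"
    "bracket G x (y + z) = bracket G x y + bracket G x z"
    "bracket G x (c *\<^sub>R y) = c *\<^sub>R bracket G x y"
    using c l r s assms by blast+
  show "bracket G x 0 = 0"
    using s[of x x 0] assms by simp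
  \<comment> \<open>Polarisation: the bracket of \<open>x + y\<close> with itself is zero, and
    expanding it leaves the two mixed terms.\<close>
  have xy: "x + y \<in> carrier G"
    using sub assms by (simp add: subspace_add)
  then have "bracket G x y + bracket G y x = 0"
    using l[OF assms(2,3) xy] r[OF assms(2,2,3)] r[OF assms(3,2,3)] a[OF xy] a assms by simp
  then show "bracket G y x = - bracket G x y"
    by (simp add: eq_neg_iff_add_eq_0 add.commute)
  show "bracket G x (bracket G y z) + bracket G y (bracket G z x) + bracket G z (bracket G x y) = 0"
    using assms unfolding lie_algebra_def by blast
qed

section \<open>Structure of a group of Heisenberg type\<close>

context
  fixes G :: "'a::real_inner step_two_group"
  assumes G: "heisenberg_type G"
begin

lemma heisenberg_type_subspaces: "subspace (hor G)" "subspace (ver G)" "subspace (carrier G)"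
  and heisenberg_type_lie_algebra: "lie_algebra G"
  and heisenberg_type_orthogonal: "z \<in> hor G \<Longrightarrow> \<sigma> \<in> ver G \<Longrightarrow> z \<bullet> \<sigma> = 0"
  using G by (simp_all add: heisenberg_type_def lie_algebra_def)

lemma hor_subset_carrier: "hor G \<subseteq> carrier G"
proof
  fix z assume "z \<in> hor G"
  then have "z + 0 \<in> carrier G"
    using subspace_0[OF heisenberg_type_subspaces(2)] unfolding carrier_def by blast
  then show "z \<in> carrier G" by simp
qed

lemma ver_subset_carrier: "ver G \<subseteq> carrier G"
proof
  fix \<sigma> assume "\<sigma> \<in> ver G"
  then have "0 + \<sigma> \<in> carrier G"
    using subspace_0[OF heisenberg_type_subspaces(1)] unfolding carrier_def by blast
  then show "\<sigma> \<in> carrier G" by simp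
qed

text \<open>The definition yields this only for horizontal \<open>x\<close>. For vertical
  \<open>x\<close>, write \<open>\<sigma>\<close> as a combination of brackets of horizontal vectors
  and apply the Jacobi identity.\<close>

lemma bracket_ver_eq_0:
  assumes "x \<in> carrier G" "\<sigma> \<in> ver G"
  shows "bracket G x \<sigma> = 0"
proof -
  note L = lie_algebra_bracket[OF heisenberg_type_lie_algebra]
  have hv: "bracket G z \<sigma> = 0" if "z \<in> hor G" "\<sigma> \<in> ver G" for z \<sigma>
    using G that unfolding heisenberg_type_def by blast
  have vh: "bracket G \<sigma> z = 0" if "z \<in> hor G" "\<sigma> \<in> ver G" for z \<sigma>
    using L(6)[of z \<sigma>] hv[OF that] that hor_subset_carrier ver_subset_carrier by auto
  have vv: "bracket G \<tau> \<sigma> = 0" if \<tau>: "\<tau> \<in> ver G" for \<tau>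
  proof -
    have c: "\<tau> \<in> carrier G"
      using \<tau> ver_subset_carrier by blast
    have "\<sigma> \<in> span {bracket G z z' | z z'. z \<in> hor G \<and> z' \<in> hor G}"
      using G assms(2) unfolding heisenberg_type_def by blast
    then have "\<sigma> \<in> carrier G \<and> bracket G \<tau> \<sigma> = 0"
    proof (induction rule: span_induct_alt)
      case base
      then show ?case
        using L(5)[OF c c c] subspace_0[OF heisenberg_type_subspaces(3)] by blast
    next
      case (step k x y)
      then obtain z z' where z: "x = bracket G z z'" "z \<in> hor G" "z' \<in> hor G"
        by blast
      then have zc: "z \<in> carrier G" "z' \<in> carrier G"
        using hor_subset_carrier by blast+
      have xc: "x \<in> carrier G"
        using L(1)[OF zc zc(1)] z by simp
      \<comment> \<open>In the Jacobi identity for \<open>\<tau>\<close>, \<open>z\<close>,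
        \<open>z'\<close> the other two terms contain a bracket of a horizontal with a vertical
        vector.\<close>
      have "bracket G \<tau> x = 0"
        using L(7)[OF c zc] hv[OF z(3) \<tau>] vh[OF z(2) \<tau>] L(5)[OF zc zc(1)] L(5)[OF zc(2,1,1)] z(1)
        by simp
      moreover have "k *\<^sub>R x \<in> carrier G"
        using xc heisenberg_type_subspaces(3) by (simp add: subspace_scale)
      ultimately show ?case
        using step L(3)[OF c, of "k *\<^sub>R x" y] L(4)[OF c xc c] xc heisenberg_type_subspaces(3)
        by (simp add: subspace_add)
    qed
    then show ?thesis by blast
  qed
  obtain z \<tau> where x: "x = z + \<tau>" "z \<in> hor G" "\<tau> \<in> ver G"
    using assms(1) unfolding carrier_def by blast
  then have "z \<in> carrier G" "\<tau> \<in> carrier G" "\<sigma> \<in> carrier G"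
    using assms hor_subset_carrier ver_subset_carrier by blast+
  then show ?thesis
    using L(2) hv[OF x(2) assms(2)] vv[OF x(3)] x(1) by simp
qed

text \<open>Vertical components are central, so only the horizontal components of \<open>x\<close>
  and \<open>y\<close> contribute, and their bracket lies in the generating set of
  \<open>ver G\<close>.\<close>

lemma bracket_carrier_in_ver:
  assumes "x \<in> carrier G" "y \<in> carrier G"
  shows "bracket G x y \<in> ver G"
proof -
  note L = lie_algebra_bracket[OF heisenberg_type_lie_algebra]
  obtain z \<tau> z' \<tau>' where x: "x = z + \<tau>" "z \<in> hor G" "\<tau> \<in> ver G"
    and y: "y = z' + \<tau>'" "z' \<in> hor G" "\<tau>' \<in> ver G"
    using assms unfolding carrier_def by blast
  have c: "z \<in> carrier G" "z' \<in> carrier G" "\<tau> \<in> carrier G" "\<tau>' \<in> carrier G"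
    using x y hor_subset_carrier ver_subset_carrier by auto
  have "bracket G x y = bracket G x z'"
    using L(3)[OF assms(1) c(2,4)] bracket_ver_eq_0[OF assms(1) y(3)] y by simp
  also have "\<dots> = bracket G z z'"
    using L(2)[OF c(1,3,2)] L(6)[OF c(2,3) c(1)] bracket_ver_eq_0[OF c(2) x(3)] x by simp
  also have "\<dots> \<in> span {bracket G z z' | z z'. z \<in> hor G \<and> z' \<in> hor G}"
    using x y by (intro span_base) blast
  also have "\<dots> = ver G"
    using G unfolding heisenberg_type_def by blast
  finally show ?thesis .
qed

text \<open>The vertical component of a vector orthogonal to \<open>ver G\<close> is orthogonal to
  itself. This recovers \<open>hor G\<close> from data that an isometric isomorphism
  preserves.\<close>

lemma hor_eq_orthogonal: "hor G = {x \<in> carrier G. \<forall>\<sigma>\<in>ver G. x \<bullet> \<sigma> = 0}"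
proof (intro equalityI subsetI)
  fix x assume x: "x \<in> {x \<in> carrier G. \<forall>\<sigma>\<in>ver G. x \<bullet> \<sigma> = 0}"
  then obtain z \<tau> where z: "x = z + \<tau>" "z \<in> hor G" "\<tau> \<in> ver G"
    unfolding carrier_def by blast
  then have "\<tau> \<bullet> \<tau> = 0"
    using x heisenberg_type_orthogonal[OF z(2,3)] by (auto simp: inner_add_left)
  then show "x \<in> hor G" using z by simp
qed (use hor_subset_carrier heisenberg_type_orthogonal in auto)

section \<open>Isomorphisms of groups carry over the maps J\<close>

lemma isomorphism_bracket:
  fixes M :: "'b::real_inner step_two_group"
  assumes lin: "linear_map_on (carrier G) f"
    and hom: "\<forall>x\<in>carrier G. \<forall>y\<in>carrier G. f (group_mult G x y) = group_mult M (f x) (f y)"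
    and xy: "x \<in> carrier G" "y \<in> carrier G"
  shows "f (bracket G x y) = bracket M (f x) (f y)"
proof -
  have b: "bracket G x y \<in> carrier G"
    using lie_algebra_bracket(1)[OF heisenberg_type_lie_algebra xy xy(1)] .
  \<comment> \<open>By linearity both products begin with \<open>f x + f y\<close>; cancelling it
    leaves half of each bracket.\<close>
  have "f (group_mult G x y) = f (x + y) + f ((1/2) *\<^sub>R bracket G x y)"
    using lin b xy heisenberg_type_subspaces(3)
    unfolding group_mult_def linear_map_on_def by (meson subspace_add subspace_scale)
  also have "\<dots> = f x + f y + (1/2) *\<^sub>R f (bracket G x y)"
    using lin b xy unfolding linear_map_on_def by simp
  finally show ?thesis
    using hom xy by (simp add: group_mult_def)
qed

text \<open>An isomorphism respects the two layers because \<open>ver\<close> is generated by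
  brackets and \<open>hor\<close> is its orthogonal complement; the maps \<open>J\<close> are then
  determined by bracket and inner product. The hypotheses on \<open>M\<close> are what is verified
  for the models.\<close>

lemma J_equivalence_of_isomorphism:
  fixes M :: "'b::real_inner step_two_group"
  assumes iso: "bij_betw f (carrier G) (carrier M)" "linear_map_on (carrier G) f"
      "\<forall>x\<in>carrier G. \<forall>y\<in>carrier G. f (group_mult G x y) = group_mult M (f x) (f y)"
      "\<forall>x\<in>carrier G. \<forall>y\<in>carrier G. f x \<bullet> f y = x \<bullet> y"
    and M: "subspace (hor M)" "subspace (ver M)"
      "ver M = {bracket M x y | x y. x \<in> carrier M \<and> y \<in> carrier M}"
      "hor M = {x \<in> carrier M. \<forall>\<sigma>\<in>ver M. x \<bullet> \<sigma> = 0}"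
      "\<And>\<sigma> z. \<sigma> \<in> ver M \<Longrightarrow> z \<in> hor M \<Longrightarrow> \<exists>w\<in>hor M. \<forall>z'\<in>hor M. w \<bullet> z' = bracket M z z' \<bullet> \<sigma>"
  shows "J_equivalence f G M"
proof -
  have br: "f (bracket G x y) = bracket M (f x) (f y)" if "x \<in> carrier G" "y \<in> carrier G" for x y
    using isomorphism_bracket[OF iso(2,3)] that by blast
  have fin: "f x \<in> carrier M" if "x \<in> carrier G" for x
    using iso(1) that by (meson bij_betwE)
  have im: "f ` carrier G = carrier M" and inj: "inj_on f (carrier G)"
    using iso(1) by (simp_all add: bij_betw_def)
  have brc: "bracket G x y \<in> carrier G" if "x \<in> carrier G" "y \<in> carrier G" for x y
    using lie_algebra_bracket(1)[OF heisenberg_type_lie_algebra] that by blast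
  \<comment> \<open>The part of \<open>carrier G\<close> mapped into \<open>ver M\<close> is a
    subspace containing all horizontal brackets, hence their span \<open>ver G\<close>.\<close>
  let ?P = "{x \<in> carrier G. f x \<in> ver M}"
  have "subspace ?P"
    unfolding subspace_def
    using heisenberg_type_subspaces(3) M(2) iso(2) linear_map_on_zero[OF iso(2)]
    by (auto simp: linear_map_on_def subspace_0 subspace_add subspace_scale)
  moreover have "{bracket G z z' | z z'. z \<in> hor G \<and> z' \<in> hor G} \<subseteq> ?P"
  proof
    fix x assume "x \<in> {bracket G z z' | z z'. z \<in> hor G \<and> z' \<in> hor G}"
    then obtain z z' where x: "x = bracket G z z'" and "z \<in> hor G" "z' \<in> hor G"
      by blast
    then have c: "z \<in> carrier G" "z' \<in> carrier G"
      using hor_subset_carrier by blast+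
    have "bracket M (f z) (f z') \<in> ver M"
      unfolding M(3) using c fin by blast
    then show "x \<in> ?P"
      using br[OF c] brc[OF c] x by simp
  qed
  ultimately have "span {bracket G z z' | z z'. z \<in> hor G \<and> z' \<in> hor G} \<subseteq> ?P"
    by (rule span_minimal[rotated])
  then have 1: "ver G \<subseteq> ?P"
    using G unfolding heisenberg_type_def by simp
  have verM: "\<exists>a b. \<tau> = bracket M a b \<and> a \<in> carrier M \<and> b \<in> carrier M" if "\<tau> \<in> ver M" for \<tau>
    using that unfolding M(3) by blast
  have ver: "f ` ver G = ver M"
  proof (intro equalityI subsetI)
    fix \<tau> assume \<tau>: "\<tau> \<in> ver M"
    \<comment> \<open>A bracket of two images under \<open>f\<close> is the image of a bracket in
      \<open>G\<close>, which is vertical.\<close>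
    then obtain a b where "\<tau> = bracket M a b" "a \<in> carrier M" "b \<in> carrier M"
      using verM by blast
    then obtain a' b' where ab': "\<tau> = f (bracket G a' b')" "a' \<in> carrier G" "b' \<in> carrier G"
      using im br by (metis imageE)
    then show "\<tau> \<in> f ` ver G"
      using bracket_carrier_in_ver by blast
  qed (use 1 in blast)
  have fhor: "f x \<in> hor M \<longleftrightarrow> x \<in> hor G" if "x \<in> carrier G" for x
  proof -
    have "f x \<in> hor M \<longleftrightarrow> (\<forall>\<sigma>\<in>ver G. f x \<bullet> f \<sigma> = 0)"
      unfolding M(4) ver[symmetric] using fin[OF that] by simp
    also have "\<dots> \<longleftrightarrow> (\<forall>\<sigma>\<in>ver G. x \<bullet> \<sigma> = 0)"
      using iso(4) that ver_subset_carrier by (metis subsetD)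
    also have "\<dots> \<longleftrightarrow> x \<in> hor G"
      using hor_eq_orthogonal that by blast
    finally show ?thesis .
  qed
  have bij: "bij_betw f (hor G) (hor M)"
    unfolding bij_betw_def
  proof
    show "inj_on f (hor G)"
      using inj hor_subset_carrier by (rule inj_on_subset)
    show "f ` hor G = hor M"
    proof (intro equalityI subsetI)
      fix y assume "y \<in> hor M"
      then obtain x where "x \<in> carrier G" "y = f x"
        using im M(4) by blast
      then show "y \<in> f ` hor G"
        using fhor \<open>y \<in> hor M\<close> by blast
    qed (use fhor hor_subset_carrier in blast)
  qed
  have J: "J_map G \<sigma> z \<in> hor G \<and> f (J_map G \<sigma> z) = J_map M (f \<sigma>) (f z)"
    if \<sigma>: "\<sigma> \<in> ver G" and z: "z \<in> hor G" for \<sigma> z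
  proof -
    have \<sigma>c: "\<sigma> \<in> carrier G" and zc: "z \<in> carrier G"
      using \<sigma> z ver_subset_carrier hor_subset_carrier by blast+
    have f: "f \<sigma> \<in> ver M" "f z \<in> hor M"
      using ver \<sigma> fhor[OF zc] z by blast+
    \<comment> \<open>Existence of the representing vector in \<open>G\<close> is pulled back from
      \<open>M\<close>: the preimage \<open>v\<close> of \<open>w\<close> works since
      \<open>f\<close> preserves inner products and brackets.\<close>
    then obtain w where w: "w \<in> hor M" "\<forall>z'\<in>hor M. w \<bullet> z' = bracket M (f z) z' \<bullet> f \<sigma>"
      using M(5) by meson
    then obtain v where v: "v \<in> hor G" "w = f v"
      using bij by (metis bij_betw_imp_surj_on imageE)
    have "v \<bullet> z' = bracket G z z' \<bullet> \<sigma>" if z': "z' \<in> hor G" for z'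
    proof -
      have z'c: "z' \<in> carrier G" and vc: "v \<in> carrier G"
        using z' v hor_subset_carrier by blast+
      have "v \<bullet> z' = w \<bullet> f z'"
        using iso(4) z'c vc v by simp
      also have "\<dots> = f (bracket G z z') \<bullet> f \<sigma>"
        using w(2) fhor[OF z'c] z' br[OF zc z'c] by simp
      also have "\<dots> = bracket G z z' \<bullet> \<sigma>"
        using iso(4) brc[OF zc z'c] \<sigma>c by simp
      finally show ?thesis .
    qed
    then have "J_map G \<sigma> z = v"
      using J_map_eqI[OF heisenberg_type_subspaces(1) v(1)] by blast
    moreover have "J_map M (f \<sigma>) (f z) = w"
      using J_map_eqI[OF M(1) w(1)] w(2) by blast
    ultimately show ?thesis
      using v by simp
  qed
  have "linear_map_on (hor G) f"
    using iso(2) hor_subset_carrier unfolding linear_map_on_def by blast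
  moreover have "\<forall>x\<in>hor G. \<forall>y\<in>hor G. f x \<bullet> f y = x \<bullet> y"
    using iso(4) hor_subset_carrier by blast
  moreover have "\<forall>\<tau>\<in>ver M. \<exists>\<sigma>\<in>ver G. \<forall>z\<in>hor G. J_map G \<sigma> z \<in> hor G \<and> f (J_map G \<sigma> z) = J_map M \<tau> (f z)"
    unfolding ver[symmetric] using J by simp metis
  moreover have "\<forall>\<sigma>\<in>ver G. \<exists>\<tau>\<in>ver M. \<forall>z\<in>hor G. J_map G \<sigma> z \<in> hor G \<and> f (J_map G \<sigma> z) = J_map M \<tau> (f z)"
    unfolding ver[symmetric] using J by simp metis
  ultimately show ?thesis
    unfolding J_equivalence_def using heisenberg_type_subspaces(1) bij by simp
qed

section \<open>The Abelian case\<close>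

text \<open>The orthogonal map taking \<open>x\<close> to \<open>y\<close> is the reflection in the hyperplane orthogonal to
  \<open>x - y\<close>.\<close>

lemma property_H_of_trivial_center:
  assumes "ver G = {0}"
  shows "property_H G"
  unfolding property_H_def
proof (intro ballI impI)
  fix x y assume xy: "x \<in> hor G" "y \<in> hor G" "norm x = 1" "norm y = 1"
  define u where "u = x - y"
  \<comment> \<open>For \<open>x = y\<close> the vector \<open>u\<close> is zero and
    \<open>S\<close> is the identity.\<close>
  define S where "S = (\<lambda>z. z - (2 * (u \<bullet> z) / (u \<bullet> u)) *\<^sub>R u)"
  have u: "u \<in> hor G"
    using xy heisenberg_type_subspaces(1) by (simp add: u_def subspace_diff)
  have Sin: "S z \<in> hor G" if "z \<in> hor G" for z
    using that u heisenberg_type_subspaces(1) by (simp add: S_def subspace_diff subspace_scale)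
  have SS: "S (S z) = z" for z
    by (cases "u = 0") (simp_all add: S_def inner_diff_right)
  have lin: "linear_map_on (hor G) S"
    by (auto simp: linear_map_on_def S_def algebra_simps inner_add_right add_divide_distrib)
  have iso: "S z \<bullet> S z' = z \<bullet> z'" for z z'
    by (cases "u = 0")
      (simp_all add: S_def inner_diff_right inner_diff_left inner_commute field_simps)
  \<comment> \<open>Both vectors have norm one, so for nonzero \<open>u\<close> the factor of
    \<open>u\<close> subtracted in \<open>S x\<close> is 1.\<close>
  have "2 * (u \<bullet> x) = u \<bullet> u"
    using xy by (simp add: u_def norm_eq_1 inner_diff_left inner_diff_right inner_commute)
  then have "S x = y"
    by (cases "u = 0") (simp_all add: S_def u_def)
  moreover have "S ` hor G = hor G"
    using Sin SS by (metis image_subset_iff subsetI subset_antisym image_eqI)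
  \<comment> \<open>With a trivial vertical layer the only map to commute with is
    \<open>J(0) = 0\<close>.\<close>
  moreover have "J_map G 0 z = 0" for z
    by (rule J_map_eqI) (use heisenberg_type_subspaces(1) in \<open>simp_all add: subspace_0\<close>)
  moreover have "S 0 = 0"
    by (simp add: S_def)
  ultimately show "\<exists>S\<in>J_commuting_group G. S x = y"
    using lin iso assms
    by (intro bexI[of _ S]) (simp_all add: J_commuting_group_def orthogonal_group_def)
qed

text \<open>Brackets are sent by \<open>f\<close> to brackets of the model, which are zero, so
  injectivity of \<open>f\<close> makes the vertical layer of \<open>G\<close> trivial.\<close>

lemma property_H_of_isomorphic_abelian:
  assumes "isometrically_isomorphic G (abelian_group n)"
  shows "property_H G"
proof -
  obtain f where iso: "bij_betw f (carrier G) (carrier (abelian_group n))"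
    "linear_map_on (carrier G) f"
    "\<forall>x\<in>carrier G. \<forall>y\<in>carrier G. f (group_mult G x y) = group_mult (abelian_group n) (f x) (f y)"
    using assms unfolding isometrically_isomorphic_def by blast
  have "bracket G x y = 0" if "x \<in> hor G" "y \<in> hor G" for x y
  proof -
    have c: "x \<in> carrier G" "y \<in> carrier G"
      using that hor_subset_carrier by blast+
    have "f (bracket G x y) = 0"
      using isomorphism_bracket[OF iso(2,3) c] by (simp add: abelian_group_def)
    moreover have "f 0 = 0"
      using linear_map_on_zero[OF iso(2)] heisenberg_type_subspaces(3) subspace_0 by blast
    ultimately show ?thesis
      using iso(1) lie_algebra_bracket(1)[OF heisenberg_type_lie_algebra c c(1)]
        subspace_0[OF heisenberg_type_subspaces(3)]
      by (metis bij_betw_imp_inj_on inj_onD)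
  qed
  then have "{bracket G z z' | z z'. z \<in> hor G \<and> z' \<in> hor G} \<subseteq> {0}"
    by blast
  then have "span {bracket G z z' | z z'. z \<in> hor G \<and> z' \<in> hor G} \<subseteq> {0}"
    by (rule span_minimal) (rule subspace_single_0)
  moreover have "span {bracket G z z' | z z'. z \<in> hor G \<and> z' \<in> hor G} = ver G"
    using G unfolding heisenberg_type_def by blast
  ultimately have "ver G = {0}"
    using subspace_0[OF heisenberg_type_subspaces(2)] by blast
  then show ?thesis
    by (rule property_H_of_trivial_center)
qed

end

section \<open>Heisenberg groups over an algebra with conjugation\<close>

text \<open>The guard at zero keeps the support finite for an arbitrary \<open>g\<close>.\<close>

lift_definition map_finseq :: "('k::zero \<Rightarrow> 'k) \<Rightarrow> 'k finseq \<Rightarrow> 'k finseq"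
  is "\<lambda>g q i. if q i = 0 then 0 else g (q i)"
  subgoal for g q
    by (rule finite_subset[of _ "{i. q i \<noteq> 0}"]) auto
  done

lemma coord_map_finseq: "g 0 = 0 \<Longrightarrow> coord (map_finseq g q) i = g (coord q i)"
  by transfer simp

text \<open>The first coordinate axis: it supplies witnesses for every \<open>n \<ge> 1\<close> and
  fills \<open>coord_space 1\<close>, which identifies the octonionic horizontal layer with the
  octonions.\<close>

lift_definition single_finseq :: "'k::zero \<Rightarrow> 'k finseq" is "\<lambda>v i. if i = 0 then v else 0"
  by simp

lemma coord_single_finseq: "coord (single_finseq v) i = (if i = 0 then v else 0)"
  by transfer simp

lemma single_finseq_eq_iff: "single_finseq v = single_finseq w \<longleftrightarrow> v = w"
  by (metis coord_single_finseq)

lemma single_finseq_in_coord_space: "n \<ge> 1 \<Longrightarrow> single_finseq v \<in> coord_space n"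
  by (simp add: coord_space_def coord_single_finseq)

lemma coord_space_1: "q \<in> coord_space 1 \<Longrightarrow> q = single_finseq (coord q 0)"
  by (rule finseq_eqI) (simp add: coord_space_def coord_single_finseq)

lemma subspace_coord_space: "subspace (coord_space n)"
  by (simp add: subspace_def coord_space_def)

lemma inner_coord_space:
  fixes p q :: "'k::real_inner finseq"
  assumes "p \<in> coord_space n"
  shows "p \<bullet> q = (\<Sum>i<n. coord p i \<bullet> coord q i)"
proof (rule inner_finseq_superset)
  show "{i. coord p i \<noteq> 0} \<subseteq> {..<n}"
    using assms by (auto simp: coord_space_def not_le[symmetric])
qed simp

text \<open>The laws common to complex numbers, quaternions and octonions, hence without
  associativity. In computing \<open>J\<close> its place is taken by \<open>inner_mult\<close>: left
  multiplications by conjugate elements are adjoint.\<close>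

locale conjugation_algebra =
  fixes m :: "'k::real_inner \<Rightarrow> 'k \<Rightarrow> 'k" and c :: "'k \<Rightarrow> 'k" and e :: 'k
  assumes mult_add_left: "m (x + y) z = m x z + m y z"
    and mult_add_right: "m z (x + y) = m z x + m z y"
    and mult_scale_left: "m (r *\<^sub>R x) z = r *\<^sub>R m x z"
    and mult_scale_right: "m z (r *\<^sub>R x) = r *\<^sub>R m z x"
    and one_left: "m e x = x"
    and one_right: "m x e = x"
    and one_nonzero: "e \<noteq> 0"
    and cnj_add: "c (x + y) = c x + c y"
    and cnj_scale: "c (r *\<^sub>R x) = r *\<^sub>R c x"
    and cnj_cnj: "c (c x) = x"
    and cnj_mult: "c (m x y) = m (c y) (c x)"
    and cnj_one: "c e = e"
    and inner_cnj: "c x \<bullet> y = x \<bullet> c y"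
    and inner_mult: "m x y \<bullet> z = y \<bullet> m (c x) z"
    and cnj_mult_self: "m (c x) x = (x \<bullet> x) *\<^sub>R e"
begin

abbreviation M :: "nat \<Rightarrow> ('k finseq \<times> 'k) step_two_group" where
  "M n \<equiv> heisenberg_group m c n"

lemma mult_zero_left: "m 0 x = 0"
  using mult_scale_left[of 0] by simp

lemma mult_zero_right: "m x 0 = 0"
  using mult_scale_right[of _ 0] by simp

lemma mult_minus_left: "m (- x) y = - m x y"
  using mult_scale_left[of "-1"] by simp

lemma mult_minus_right: "m y (- x) = - m y x"
  using mult_scale_right[of _ "-1"] by simp

lemma mult_diff_left: "m (x - y) z = m x z - m y z"
  using mult_add_left[of x "- y"] by (simp add: mult_minus_left)

lemma mult_diff_right: "m z (x - y) = m z x - m z y"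
  using mult_add_right[of _ x "- y"] by (simp add: mult_minus_right)

lemma cnj_zero: "c 0 = 0"
  using cnj_scale[of 0] by simp

lemma cnj_minus: "c (- x) = - c x"
  using cnj_scale[of "-1"] by simp

lemma cnj_diff: "c (x - y) = c x - c y"
  using cnj_add[of x "- y"] by (simp add: cnj_minus)

lemma mult_sum_left: "m (\<Sum>i\<in>A. g i) x = (\<Sum>i\<in>A. m (g i) x)"
  by (induction A rule: infinite_finite_induct) (simp_all add: mult_zero_left mult_add_left)

lemma cnj_sum: "c (\<Sum>i\<in>A. g i) = (\<Sum>i\<in>A. c (g i))"
  by (induction A rule: infinite_finite_induct) (simp_all add: cnj_zero cnj_add)

text \<open>\<open>im_part c\<close> is the projection onto the elements reversed in sign by
  \<open>c\<close>; the vertical layer becomes the solution set of an equation.\<close>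

lemma range_im_part: "range (im_part c) = {s. c s = - s}"
proof (intro equalityI subsetI)
  fix s assume "s \<in> {s. c s = - s}"
  then have "im_part c s = s"
    by (simp add: im_part_def scaleR_2[symmetric])
  then show "s \<in> range (im_part c)"
    by (metis rangeI)
qed (auto simp: im_part_def cnj_scale cnj_diff cnj_cnj scaleR_minus_right[symmetric]
      simp del: scaleR_minus_right)

lemma im_part_inner:
  assumes "c s = - s"
  shows "im_part c x \<bullet> s = x \<bullet> s"
  using inner_cnj[of x s] assms by (simp add: im_part_def inner_diff_left)

text \<open>The standard hermitian form with values in the algebra; its imaginary part is the
  bracket.\<close>

definition herm :: "nat \<Rightarrow> 'k finseq \<Rightarrow> 'k finseq \<Rightarrow> 'k" where
  "herm n p q = (\<Sum>i<n. m (c (coord p i)) (coord q i))"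

definition rmult :: "'k finseq \<Rightarrow> 'k \<Rightarrow> 'k finseq" where
  "rmult q s = map_finseq (\<lambda>x. m x s) q"

lemma coord_rmult: "coord (rmult q s) i = m (coord q i) s"
  by (simp add: rmult_def coord_map_finseq mult_zero_left)

lemma rmult_in_coord_space: "q \<in> coord_space n \<Longrightarrow> rmult q s \<in> coord_space n"
  by (simp add: coord_space_def coord_rmult mult_zero_left)

section \<open>The models and their maps J\<close>

lemma heisenberg_group_simps:
  "hor (M n) = coord_space n \<times> {0}"
  "ver (M n) = {0} \<times> {s. c s = - s}"
  "bracket (M n) x y = (0, im_part c (herm n (fst x) (fst y)))"
  by (simp_all add: heisenberg_group_def herm_def range_im_part)

lemma carrier_heisenberg_group: "carrier (M n) = coord_space n \<times> {s. c s = - s}"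
  unfolding carrier_def heisenberg_group_simps by force

lemma subspace_imaginary: "subspace {s. c s = - s}"
  by (simp add: subspace_def cnj_zero cnj_add cnj_scale)

lemma subspace_hor: "subspace (hor (M n))"
  unfolding heisenberg_group_simps
  by (intro subspace_Times subspace_coord_space subspace_single_0)

lemma subspace_ver: "subspace (ver (M n))"
  unfolding heisenberg_group_simps
  by (intro subspace_Times subspace_imaginary subspace_single_0)

lemma im_part_imaginary: "c (im_part c x) = - im_part c x"
  using range_im_part by blast

lemma im_part_eq_self: "c s = - s \<Longrightarrow> im_part c s = s"
  by (simp add: im_part_def scaleR_2[symmetric])

lemma herm_single: "n \<ge> 1 \<Longrightarrow> herm n (single_finseq x) (single_finseq y) = m (c x) y"
proof -
  assume "n \<ge> 1"
  then have "herm n (single_finseq x) (single_finseq y) = (\<Sum>i\<in>{0::nat}. m (c x) y)"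
    unfolding herm_def
    by (intro sum.mono_neutral_cong_right)
      (auto simp: coord_single_finseq cnj_zero mult_zero_left mult_zero_right)
  then show ?thesis by simp
qed

text \<open>An imaginary \<open>s\<close> is already a single bracket, that of the unit
  \<open>e\<close> and \<open>s\<close> placed in the first coordinate.\<close>

lemma ver_eq_brackets:
  assumes "n \<ge> 1"
  shows "ver (M n) = {bracket (M n) x y | x y. x \<in> carrier (M n) \<and> y \<in> carrier (M n)}"
proof (intro equalityI subsetI)
  fix \<tau> assume "\<tau> \<in> ver (M n)"
  then obtain s where s: "\<tau> = (0, s)" "c s = - s"
    unfolding heisenberg_group_simps by blast
  let ?x = "(single_finseq e, 0)" and ?y = "(single_finseq s, 0)"
  have "?x \<in> carrier (M n)" "?y \<in> carrier (M n)"
    unfolding carrier_heisenberg_group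
    using assms by (simp_all add: single_finseq_in_coord_space cnj_zero)
  moreover have "\<tau> = bracket (M n) ?x ?y"
    using s assms by (simp add: heisenberg_group_simps herm_single cnj_one one_left im_part_eq_self)
  ultimately show "\<tau> \<in> {bracket (M n) x y | x y. x \<in> carrier (M n) \<and> y \<in> carrier (M n)}"
    by blast
qed (auto simp: heisenberg_group_simps im_part_imaginary)

lemma hor_eq_orthogonal_ver: "hor (M n) = {x \<in> carrier (M n). \<forall>\<sigma>\<in>ver (M n). x \<bullet> \<sigma> = 0}"
proof (intro equalityI subsetI)
  fix x assume x: "x \<in> {x \<in> carrier (M n). \<forall>\<sigma>\<in>ver (M n). x \<bullet> \<sigma> = 0}"
  then have "c (snd x) = - snd x" "fst x \<in> coord_space n"
    by (auto simp: carrier_heisenberg_group)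
  moreover from this have "x \<bullet> (0, snd x) = 0"
    using x by (auto simp: heisenberg_group_simps)
  ultimately show "x \<in> hor (M n)"
    by (cases x) (simp add: inner_prod_def heisenberg_group_simps)
qed (auto simp: carrier_heisenberg_group heisenberg_group_simps cnj_zero)

text \<open>Coordinatewise, left multiplication by \<open>coord p i\<close> moves to the other side
  as its conjugate. No associativity enters, so right multiplication represents \<open>J\<close> for
  octonions too.\<close>

lemma inner_rmult: "p \<in> coord_space n \<Longrightarrow> rmult p s \<bullet> q = s \<bullet> herm n p q"
  by (simp add: inner_coord_space[OF rmult_in_coord_space] coord_rmult herm_def inner_sum_right
      inner_mult)

lemma J_representative:
  assumes "c s = - s" "p \<in> coord_space n" "z' \<in> hor (M n)"
  shows "(rmult p s, 0) \<bullet> z' = bracket (M n) (p, 0) z' \<bullet> (0, s)"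
  using assms by (auto simp: heisenberg_group_simps inner_rmult im_part_inner)
    (rule inner_commute)

lemma J_map_heisenberg_group:
  assumes "c s = - s" "p \<in> coord_space n"
  shows "J_map (M n) (0, s) (p, 0) = (rmult p s, 0)"
  using assms
  by (intro J_map_eqI subspace_hor J_representative)
    (simp_all add: heisenberg_group_simps rmult_in_coord_space)

lemma J_equivalence_heisenberg_group:
  fixes G :: "'a::real_inner step_two_group"
  assumes "heisenberg_type G" "n \<ge> 1" "isometrically_isomorphic G (M n)"
  obtains f where "J_equivalence f G (M n)"
proof -
  have J: "\<exists>w\<in>hor (M n). \<forall>z'\<in>hor (M n). w \<bullet> z' = bracket (M n) z z' \<bullet> \<sigma>"
    if "\<sigma> \<in> ver (M n)" "z \<in> hor (M n)" for \<sigma> z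
  proof -
    from that obtain s p where sp: "\<sigma> = (0, s)" "c s = - s" "z = (p, 0)" "p \<in> coord_space n"
      unfolding heisenberg_group_simps by blast
    have "(rmult p s, 0) \<in> hor (M n)"
      using sp by (simp add: heisenberg_group_simps rmult_in_coord_space)
    then show ?thesis
      using J_representative[OF sp(2,4)] sp(1,3) by blast
  qed
  obtain f where f: "bij_betw f (carrier G) (carrier (M n))" "linear_map_on (carrier G) f"
    "\<forall>x\<in>carrier G. \<forall>y\<in>carrier G. f (group_mult G x y) = group_mult (M n) (f x) (f y)"
    "\<forall>x\<in>carrier G. \<forall>y\<in>carrier G. f x \<bullet> f y = x \<bullet> y"
    using assms(3) unfolding isometrically_isomorphic_def by blast
  have "J_equivalence f G (M n)"
    using J_equivalence_of_isomorphism[OF assms(1) f subspace_hor subspace_ver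
        ver_eq_brackets[OF assms(2)] hor_eq_orthogonal_ver J] by blast
  then show thesis
    by (rule that)
qed

end

section \<open>Transitivity over an associative algebra\<close>

locale associative_conjugation_algebra = conjugation_algebra m c e
  for m :: "'k::real_inner \<Rightarrow> 'k \<Rightarrow> 'k" and c e +
  assumes assoc: "m (m x y) z = m x (m y z)"
begin

lemma herm_rmult_right: "herm n p (rmult q s) = m (herm n p q) s"
  by (simp add: herm_def coord_rmult mult_sum_left assoc)

lemma herm_diff_left: "herm n (p - q) r = herm n p r - herm n q r"
  by (simp add: herm_def cnj_diff mult_diff_left sum_subtractf)

lemma herm_diff_right: "herm n p (q - r) = herm n p q - herm n p r"
  by (simp add: herm_def mult_diff_right sum_subtractf)

lemma herm_add_right: "herm n p (q + r) = herm n p q + herm n p r"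
  by (simp add: herm_def mult_add_right sum.distrib)

lemma herm_scale_right: "herm n p (r *\<^sub>R q) = r *\<^sub>R herm n p q"
  by (simp add: herm_def mult_scale_right scaleR_sum_right)

lemma cnj_herm: "c (herm n p q) = herm n q p"
  by (simp add: herm_def cnj_sum cnj_mult cnj_cnj)

lemma herm_self: "p \<in> coord_space n \<Longrightarrow> herm n p p = (p \<bullet> p) *\<^sub>R e"
  by (simp add: herm_def cnj_mult_self inner_coord_space scaleR_left.sum)

lemma rmult_simps:
  "rmult (p + q) s = rmult p s + rmult q s" "rmult (p - q) s = rmult p s - rmult q s"
  "rmult (r *\<^sub>R p) s = r *\<^sub>R rmult p s"
  "rmult p (s + t) = rmult p s + rmult p t" "rmult p (s - t) = rmult p s - rmult p t"
  "rmult p (r *\<^sub>R s) = r *\<^sub>R rmult p s"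
  "rmult (rmult p s) t = rmult p (m s t)" "rmult p e = p" "rmult p 0 = 0"
  by (rule finseq_eqI; simp add: coord_rmult mult_add_left mult_add_right mult_diff_left
      mult_diff_right mult_scale_left mult_scale_right mult_zero_right assoc one_right)+

lemma mult_cnj_self: "m x (c x) = (c x \<bullet> c x) *\<^sub>R e"
  using cnj_mult_self[of "c x"] by (simp add: cnj_cnj)

lemma inner_cnj_cnj: "c x \<bullet> c y = x \<bullet> y"
  by (simp add: inner_cnj cnj_cnj)

text \<open>The map \<open>z \<mapsto> z - u a \<langle>u, z\<rangle>\<close> fixes the orthogonal complement of \<open>u\<close>; it is unitary as soon
  as \<open>a + a\<^sup>* = |u|\<^sup>2 a\<^sup>* a\<close>. For unit vectors \<open>x \<noteq> y\<close>, \<open>u = x - y\<close> and \<open>d = \<langle>u, x\<rangle>\<close> one has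
  \<open>d + d\<^sup>* = |u|\<^sup>2\<close>, so \<open>a = d\<^sup>-\<^sup>1\<close> satisfies this condition, and \<open>x\<close> is taken to \<open>y\<close>.\<close>

definition quasi_reflection :: "nat \<Rightarrow> 'k finseq \<Rightarrow> 'k \<Rightarrow> 'k finseq \<Rightarrow> 'k finseq" where
  "quasi_reflection n u a z = z - rmult u (m a (herm n u z))"

lemma quasi_reflection_in_coord_space:
  "u \<in> coord_space n \<Longrightarrow> z \<in> coord_space n \<Longrightarrow> quasi_reflection n u a z \<in> coord_space n"
  by (simp add: quasi_reflection_def subspace_diff subspace_coord_space rmult_in_coord_space)

lemma linear_map_on_quasi_reflection: "linear_map_on U (quasi_reflection n u a)"
  by (simp add: linear_map_on_def quasi_reflection_def herm_add_right herm_scale_right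
      mult_add_right mult_scale_right rmult_simps scaleR_diff_right)

text \<open>Commutation with \<open>J\<close>: a right factor \<open>s\<close> passes out of the
  form and then, by associativity, out of the correction term.\<close>

lemma quasi_reflection_rmult:
  "quasi_reflection n u a (rmult z s) = rmult (quasi_reflection n u a z) s"
  by (simp add: quasi_reflection_def herm_rmult_right rmult_simps assoc)

text \<open>Composing the maps for \<open>c a\<close> and \<open>a\<close> leaves a correction with
  the factor \<open>a + c a - (u \<bullet> u) *\<^sub>R m a (c a)\<close>, which vanishes. This
  supplies surjectivity in the transitivity proof.\<close>

lemma quasi_reflection_inverse:
  assumes u: "u \<in> coord_space n" and a: "a + c a = (u \<bullet> u) *\<^sub>R m a (c a)"
  shows "quasi_reflection n u a (quasi_reflection n u (c a) z) = z"
proof -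
  define h where "h = herm n u z"
  have "herm n u (rmult u (m (c a) h)) = (u \<bullet> u) *\<^sub>R m (c a) h"
    by (simp add: herm_rmult_right herm_self[OF u] mult_scale_left one_left)
  then have "quasi_reflection n u a (quasi_reflection n u (c a) z)
      = z - rmult u (m (c a) h + m a h - (u \<bullet> u) *\<^sub>R m a (m (c a) h))"
    by (simp add: quasi_reflection_def h_def[symmetric] herm_diff_right mult_diff_right
        mult_scale_right rmult_simps algebra_simps)
  also have "m (c a) h + m a h - (u \<bullet> u) *\<^sub>R m a (m (c a) h) = m (a + c a - (u \<bullet> u) *\<^sub>R m a (c a)) h"
    by (simp add: mult_add_left mult_diff_left mult_scale_left assoc add.commute)
  finally show ?thesis
    using a by (simp add: mult_zero_left rmult_simps)
qed

text \<open>Left multiplication by \<open>a\<close> has adjoint left multiplication by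
  \<open>c a\<close>, so the change of the inner product collects into one factor that is zero by
  assumption.\<close>

lemma quasi_reflection_inner:
  assumes u: "u \<in> coord_space n" and a: "a + c a = (u \<bullet> u) *\<^sub>R m (c a) a"
  shows "quasi_reflection n u a z \<bullet> quasi_reflection n u a z' = z \<bullet> z'"
proof -
  define h h' where "h = herm n u z" and "h' = herm n u z'"
  have 1: "z \<bullet> rmult u t = h \<bullet> t" for t
    using inner_rmult[OF u, of t z] by (simp add: inner_commute h_def)
  have 2: "rmult u t \<bullet> z' = t \<bullet> h'" for t
    using inner_rmult[OF u] by (simp add: h'_def)
  have 3: "rmult u s \<bullet> rmult u t = (u \<bullet> u) * (s \<bullet> t)" for s t
    using inner_rmult[OF u, of s]
    by (simp add: herm_rmult_right herm_self[OF u] mult_scale_left one_left)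
  have "quasi_reflection n u a z \<bullet> quasi_reflection n u a z'
      = z \<bullet> z' - (h \<bullet> m a h' + m a h \<bullet> h' - (u \<bullet> u) * (m a h \<bullet> m a h'))"
    by (simp add: quasi_reflection_def inner_diff_left inner_diff_right 1 2 3
        h_def[symmetric] h'_def[symmetric] algebra_simps)
  also have "h \<bullet> m a h' + m a h \<bullet> h' - (u \<bullet> u) * (m a h \<bullet> m a h')
      = h \<bullet> m (a + c a - (u \<bullet> u) *\<^sub>R m (c a) a) h'"
    by (simp add: inner_mult mult_add_left mult_diff_left mult_scale_left assoc inner_add_right
        inner_diff_right)
  finally show ?thesis
    using a by (simp add: mult_zero_left)
qed

lemma property_H_heisenberg_group: "property_H (M n)"
  unfolding property_H_def
proof (intro ballI impI)
  fix x' y' assume "x' \<in> hor (M n)" "y' \<in> hor (M n)" and norm: "norm x' = 1" "norm y' = 1"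
  then obtain x y where x: "x' = (x, 0)" "x \<in> coord_space n" and y: "y' = (y, 0)" "y \<in> coord_space n"
    unfolding heisenberg_group_simps by blast
  have n: "x \<bullet> x = 1" "y \<bullet> y = 1"
    using norm x y by (simp_all add: norm_eq_1)
  define u where "u = x - y"
  define d where "d = herm n u x"
  \<comment> \<open>The inverse of \<open>d\<close>, by \<open>cnj_mult_self\<close>. For
    \<open>x = y\<close> division by zero makes it 0, and the map is the identity.\<close>
  define a where "a = (1 / (d \<bullet> d)) *\<^sub>R c d"
  have u: "u \<in> coord_space n"
    using x y by (simp add: u_def subspace_diff subspace_coord_space)
  \<comment> \<open>As \<open>x\<close> and \<open>y\<close> are unit vectors, expanding
    \<open>herm n u u\<close> gives exactly \<open>d + c d\<close>.\<close>
  have "d = e - herm n y x"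
    using x y n by (simp add: d_def u_def herm_diff_left herm_self)
  moreover have "herm n u u = e - herm n y x - herm n x y + e"
    using x y n by (simp add: u_def herm_diff_left herm_diff_right herm_self)
  ultimately have d: "d + c d = (u \<bullet> u) *\<^sub>R e"
    using herm_self[OF u] by (simp add: cnj_diff cnj_one cnj_herm)
  have d0: "d \<noteq> 0" if "u \<noteq> 0"
    using d that one_nonzero by (auto simp: cnj_zero)
  have ca: "c a = (1 / (d \<bullet> d)) *\<^sub>R d"
    by (simp add: a_def cnj_scale cnj_cnj)
  have "a + c a = (1 / (d \<bullet> d)) *\<^sub>R (d + c d)"
    by (simp add: ca) (simp add: a_def scaleR_add_right)
  also have "\<dots> = ((u \<bullet> u) / (d \<bullet> d)) *\<^sub>R e"
    by (simp add: d)
  finally have sum: "a + c a = ((u \<bullet> u) / (d \<bullet> d)) *\<^sub>R e" .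
  have prod: "m a (c a) = (1 / (d \<bullet> d)) *\<^sub>R e" "m (c a) a = (1 / (d \<bullet> d)) *\<^sub>R e"
    by (cases "d = 0"; simp add: ca; simp add: a_def mult_scale_left mult_scale_right
        cnj_mult_self mult_cnj_self inner_cnj_cnj mult_zero_left mult_zero_right cnj_zero)+
  let ?Q = "quasi_reflection n u a"
  have inv: "?Q (quasi_reflection n u (c a) z) = z" for z
    by (rule quasi_reflection_inverse[OF u]) (simp add: sum prod)
  have inner: "?Q z \<bullet> ?Q z' = z \<bullet> z'" for z z'
    by (rule quasi_reflection_inner[OF u]) (simp add: sum prod)
  have Qx: "?Q x = y"
  proof (cases "u = 0")
    case True
    then show ?thesis
      by (simp add: quasi_reflection_def u_def coord_rmult mult_zero_left finseq_eqI)
  next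
    case False
    \<comment> \<open>The correction term at \<open>x\<close> is \<open>u\<close> times
      \<open>m a d\<close>, so exactly \<open>u\<close> is subtracted.\<close>
    then have "m a d = e"
      using d0 by (simp add: a_def mult_scale_left cnj_mult_self)
    then have "?Q x = x - u"
      by (simp add: quasi_reflection_def d_def[symmetric] rmult_simps)
    then show ?thesis
      by (simp add: u_def)
  qed
  let ?S = "\<lambda>z. (?Q (fst z), 0)"
  have "?S ` hor (M n) = hor (M n)"
  proof (intro equalityI subsetI)
    fix z assume "z \<in> hor (M n)"
    then obtain q where q: "z = (q, 0)" "q \<in> coord_space n"
      unfolding heisenberg_group_simps by blast
    have "(quasi_reflection n u (c a) q, 0) \<in> hor (M n)"
      using q u by (simp add: heisenberg_group_simps quasi_reflection_in_coord_space)
    moreover have "z = ?S (quasi_reflection n u (c a) q, 0)"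
      using q inv by simp
    ultimately show "z \<in> ?S ` hor (M n)"
      by blast
  qed (use u in \<open>auto simp: heisenberg_group_simps quasi_reflection_in_coord_space\<close>)
  moreover have "linear_map_on (hor (M n)) ?S"
    using linear_map_on_quasi_reflection[of UNIV n u a] by (simp add: linear_map_on_def)
  moreover have "\<forall>z\<in>hor (M n). \<forall>z'\<in>hor (M n). ?S z \<bullet> ?S z' = z \<bullet> z'"
    by (auto simp: heisenberg_group_simps inner)
  moreover have "\<forall>\<sigma>\<in>ver (M n). \<forall>z\<in>hor (M n). ?S (J_map (M n) \<sigma> z) = J_map (M n) \<sigma> (?S z)"
    using u by (auto simp: heisenberg_group_simps J_map_heisenberg_group
        quasi_reflection_in_coord_space quasi_reflection_rmult)
  ultimately have "?S \<in> J_commuting_group (M n)"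
    by (simp add: J_commuting_group_def orthogonal_group_def)
  moreover have "?S x' = y'"
    using x y Qx by simp
  ultimately show "\<exists>S\<in>J_commuting_group (M n). S x' = y'"
    by (intro bexI[of _ ?S])
qed

lemma property_H_of_isomorphic_heisenberg_group:
  fixes G :: "'a::real_inner step_two_group"
  assumes "heisenberg_type G" "n \<ge> 1" "isometrically_isomorphic G (M n)"
  shows "property_H G"
  using J_equivalence_heisenberg_group[OF assms] property_H_J_equivalence subspace_hor
    property_H_heisenberg_group by metis

end

section \<open>The complex numbers, quaternions and octonions as instances\<close>

interpretation complex: associative_conjugation_algebra "(*) :: complex \<Rightarrow> complex \<Rightarrow> complex" cnj 1
  by unfold_locales (simp_all add: complex_eq_iff inner_complex_def algebra_simps)

lemmas quat_defs = quat_mult_def quat_cnj_def cd_mult_def cd_cnj_def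

lemmas oct_defs = oct_mult_def oct_cnj_def quat_defs

interpretation quat: associative_conjugation_algebra quat_mult quat_cnj "(1, 0)"
  by unfold_locales
    (simp_all add: quat_defs prod_eq_iff inner_prod_def complex_eq_iff inner_complex_def algebra_simps)

text \<open>Octonion multiplication is not associative, so only the weaker locale holds.\<close>

interpretation oct: conjugation_algebra oct_mult oct_cnj "((1, 0), 0)"
  by unfold_locales
    (simp_all add: oct_defs prod_eq_iff inner_prod_def complex_eq_iff inner_complex_def algebra_simps)

section \<open>The octonionic Heisenberg group\<close>

text \<open>A map \<open>S\<close> taking \<open>1\<close> to \<open>l\<close> and commuting with \<open>J\<close> has \<open>S s = l s\<close> and
  \<open>S (s t) = (l s) t\<close> for imaginary \<open>s\<close>, \<open>t\<close>. For the basic units \<open>i\<close>, \<open>j\<close> and \<open>l\<close> the octonion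
  \<open>i j\<close> is imaginary too, but \<open>(l i) j = - l (i j)\<close>.\<close>

lemma not_property_H_octonionic_heisenberg_group: "\<not> property_H octonionic_heisenberg_group"
proof
  let ?G = octonionic_heisenberg_group
  \<comment> \<open>\<open>b\<close> is the unit of the algebra, \<open>i\<close> and
    \<open>j\<close> lie in the quaternion subalgebra, and \<open>l\<close> is the unit added by the
    last doubling.\<close>
  define i j k l b :: oct
    where "i = ((\<i>, 0), 0)" and "j = ((0, 1), 0)" and "k = oct_mult i j" and "l = (0, (1, 0))"
      and "b = ((1, 0), 0)"
  note units = i_def j_def k_def l_def b_def
  let ?v = "\<lambda>x. (single_finseq x, 0) :: oct finseq \<times> oct"
  have hor: "hor ?G = range ?v"
  proof (intro equalityI subsetI)
    fix z assume "z \<in> hor ?G"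
    then obtain q where "z = (q, 0)" "q \<in> coord_space 1"
      unfolding octonionic_heisenberg_group_def oct.heisenberg_group_simps by blast
    then show "z \<in> range ?v"
      using coord_space_1 by blast
  qed (auto simp: octonionic_heisenberg_group_def oct.heisenberg_group_simps
        single_finseq_in_coord_space)
  have J: "J_map ?G (0, s) (?v x) = ?v (oct_mult x s)" if "oct_cnj s = - s" for s x
  proof -
    have "oct.rmult (single_finseq x) s = single_finseq (oct_mult x s)"
      by (rule finseq_eqI) (simp add: oct.coord_rmult coord_single_finseq oct.mult_zero_left)
    then show ?thesis
      using that by (simp add: octonionic_heisenberg_group_def oct.J_map_heisenberg_group
          single_finseq_in_coord_space)
  qed
  assume "property_H ?G"
  moreover have "norm (?v b) = 1" "norm (?v l) = 1"
    by (simp_all add: norm_eq_1 inner_coord_space[OF single_finseq_in_coord_space[OF order_refl]]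
        coord_single_finseq units inner_complex_def)
  ultimately obtain S where S: "S \<in> J_commuting_group ?G" "S (?v b) = ?v l"
    using hor unfolding property_H_def by blast
  have SJ: "S (?v (oct_mult x s)) = ?v (oct_mult y s)"
    if "S (?v x) = ?v y" "oct_cnj s = - s" for x y s
  proof -
    have "(0, s) \<in> ver ?G"
      using that by (simp add: octonionic_heisenberg_group_def oct.heisenberg_group_simps)
    then have "S (J_map ?G (0, s) (?v x)) = J_map ?G (0, s) (S (?v x))"
      using S(1) hor unfolding J_commuting_group_def by blast
    then show ?thesis
      using that J by simp
  qed
  have im: "oct_cnj i = - i" "oct_cnj j = - j" "oct_cnj k = - k"
    by (simp_all add: units oct_defs prod_eq_iff)
  \<comment> \<open>From \<open>?v b\<close> the vector \<open>?v k\<close> is reached in one step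
    by \<open>J(k)\<close> and in two by \<open>J(i)\<close> and \<open>J(j)\<close>; the two
    resulting values of \<open>S\<close> have to agree.\<close>
  have "S (?v i) = ?v (oct_mult l i)" "S (?v k) = ?v (oct_mult l k)"
    using SJ[OF S(2)] im oct.one_left unfolding b_def by metis+
  moreover from this(1) have "S (?v k) = ?v (oct_mult (oct_mult l i) j)"
    using SJ im unfolding k_def by blast
  ultimately have "?v (oct_mult l k) = ?v (oct_mult (oct_mult l i) j)"
    by simp
  then have "oct_mult l k = oct_mult (oct_mult l i) j"
    by (simp add: single_finseq_eq_iff)
  then show False
    by (simp add: units oct_defs)
qed

section \<open>The dimension, and transfer to isomorphic groups\<close>

lemma dim_octonionic_heisenberg_group: "dim (carrier octonionic_heisenberg_group) = 15"
proof -
  let ?I = "{s. oct_cnj s = - s}"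
  \<comment> \<open>Coordinates in a Euclidean space, where products and hyperplanes have known
    dimensions.\<close>
  let ?W = "(UNIV :: oct set) \<times> ?I"
  let ?g = "\<lambda>x. (single_finseq (fst x), snd x) :: oct finseq \<times> oct"
  have carrier: "carrier octonionic_heisenberg_group = coord_space 1 \<times> ?I"
    by (simp add: octonionic_heisenberg_group_def oct.carrier_heisenberg_group)
  have lin: "linear_map_on ?W ?g"
    by (simp add: linear_map_on_def prod_eq_iff)
      (auto intro!: finseq_eqI simp: coord_single_finseq)
  have "inj_on ?g ?W"
    by (auto simp: inj_on_def single_finseq_eq_iff)
  moreover have "?g ` ?W = carrier octonionic_heisenberg_group"
    unfolding carrier
  proof (intro equalityI subsetI)
    fix z :: "oct finseq \<times> oct" assume z: "z \<in> coord_space 1 \<times> ?I"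
    then have "z = ?g (coord (fst z) 0, snd z)"
      using coord_space_1[of "fst z"] by (simp add: mem_Times_iff prod_eq_iff)
    then show "z \<in> ?g ` ?W"
      by (rule image_eqI) (use z in \<open>simp add: mem_Times_iff\<close>)
  qed (auto simp: single_finseq_in_coord_space)
  ultimately have "bij_betw ?g ?W (carrier octonionic_heisenberg_group)"
    by (simp add: bij_betw_def)
  then have "dim (carrier octonionic_heisenberg_group) = dim ?W"
    using lin
    by (intro dim_eq_of_linear_bij[of _ ?g] subspace_Times subspace_UNIV oct.subspace_imaginary)
  also have "\<dots> = dim (UNIV :: oct set) + dim ?I"
    by (intro dim_Times subspace_UNIV oct.subspace_imaginary)
  \<comment> \<open>The imaginary octonions are the hyperplane orthogonal to 1, so the total is 8 +
    7.\<close>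
  also have "?I = {s. ((1, 0), 0) \<bullet> s = 0}"
    by (intro Collect_cong) (simp add: oct_defs inner_prod_def inner_complex_def prod_eq_iff complex_eq_iff)
  also have "dim \<dots> = DIM(oct) - 1"
    by (rule dim_hyperplane) (simp add: prod_eq_iff)
  finally show ?thesis
    by (simp add: DIM_prod)
qed

lemma octonionic_dim:
  fixes G :: "'a::real_inner step_two_group"
  assumes "heisenberg_type G" "octonionic G"
  shows "dim (carrier G) = 15"
  using assms dim_eq_of_linear_bij[OF heisenberg_type_subspaces(3)] dim_octonionic_heisenberg_group
  unfolding octonionic_def isometrically_isomorphic_def by metis

text \<open>The inverse equivalence would carry property (H) from \<open>G\<close> to the octonionic
  model, where it fails.\<close>

lemma octonionic_not_property_H:
  fixes G :: "'a::real_inner step_two_group"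
  assumes "heisenberg_type G" "octonionic G"
  shows "\<not> property_H G"
proof
  assume H: "property_H G"
  obtain f where f: "J_equivalence f G (heisenberg_group oct_mult oct_cnj 1)"
    using oct.J_equivalence_heisenberg_group[OF assms(1) order_refl] assms(2)
    unfolding octonionic_def octonionic_heisenberg_group_def by blast
  show False
    using property_H_J_equivalence[OF J_equivalence_inverse[OF f oct.subspace_hor]
        heisenberg_type_subspaces(1)[OF assms(1)] H]
      not_property_H_octonionic_heisenberg_group
    by (simp add: octonionic_heisenberg_group_def)
qed

theorem proposition1p5:
  fixes G :: "'a::real_inner step_two_group"
  assumes "iwasawa_type G"
  shows "(\<not> octonionic G \<longrightarrow> property_H G) \<and>
         (octonionic G \<longrightarrow> real_vector.dim (carrier G) = 15 \<and> \<not> property_H G)"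
  using assms octonionic_dim octonionic_not_property_H property_H_of_isomorphic_abelian
    complex.property_H_of_isomorphic_heisenberg_group
    quat.property_H_of_isomorphic_heisenberg_group
  unfolding iwasawa_type_def by blast

end
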